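(* Consider the problem $f_0^*=\min_{x\in Q}\{f_0(x):\ f_i(x)\le0,\ i=1,\dots,m\}$, where $Q$ is a closed convex (possibly unbounded) set, and assume it has an optimal solution $x^*$. Let $\mathcal{F}=\{x\in Q:\ f_i(x)\le0,\ i=1,\dots,m\}$, let $D\ge\beta_d(x_0,x^* )$, and suppose $$\|f_i'(x)\|_*\le M,\qquad x\in Q,\ i=0,\dots,m,$$ with $M>0$. Let the sequences $\{x_k\},\{y_k\}$ be generated by the Switching Subgradient Method for Unbounded Sets described in the context, with tolerance $\epsilon>0$, parameter $D_0>0$ and coefficients $\{\gamma_k\}_{k\ge0}$ satisfying $\gamma_{k+1}>\gamma_k\ge0$. Let $N\ge1$ and $$\Sigma_N=\frac{1}{\gamma_N}\sum_{k=0}^{N-1}\big[\gamma_{k+1}(\gamma_{k+1}-\gamma_k)\big]^{1/2}.$$ If $$\Sigma_N>\frac{\rho_0+D_0}{\sqrt{2D_0}}\cdot\frac{M}{\epsilon},\qquad \rho_0=\min_{y\in\mathcal{F}}\beta_d(x_0,y),$$ then $\mathcal{S}_0(N)\ne\emptyset$ and $\hat\sigma_0(N)>0$. Moreover, if $$\Sigma_N>\frac{D+D_0}{\sqrt{2D_0}}\cdot\frac{M}{\epsilon},$$ then $$f_0^*(N)-f_0^*\ \le\ f_0^*(N)-\phi_D(\hat\lambda(N))\ \le\ \epsilon,$$ where $f_0^*(N)=\min_{k\in\mathcal{S}_0(N)}f_0(y_k)$.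
   Context: $\mathbb{E}$ is a finite-dimensional real vector space with dual $\mathbb{E}^*$, $\langle s,x\rangle$ is the value of $s\in\mathbb{E}^*$ at $x$, $\|\cdot\|$ is an arbitrary norm on $\mathbb{E}$ and $\|g\|_*=\max\{\langle g,x\rangle:\|x\|\le1\}$. The functions $f_0,\dots,f_m$ are closed, convex and subdifferentiable on $Q$; $f_i'(x)$ is a fixed subgradient of $f_i$ at $x\in Q$. Prox-function: $d$ is continuously differentiable on a convex open domain $\mathrm{dom}\,d\supseteq Q$ with $d(y)\ge d(x)+\langle\nabla d(x),y-x\rangle+\frac12\|y-x\|^2$. Bregman distance: $\beta_d(x,y)=d(y)-d(x)-\langle\nabla d(x),y-x\rangle$. It is assumed to be convex in its first argument: $\beta_d(\alpha u_1+(1-\alpha)u_2,x)\le\alpha\beta_d(u_1,x)+(1-\alpha)\beta_d(u_2,x)$ for all $u_1,u_2,x\in Q$, $\alpha\in[0,1]$. For $y\in Q$, $\lambda\ge0$, $i=0,\dots,m$: $\varphi_{i,y}(\lambda)=\max_{T\in Q}\{\lambda\langle f_i'(y),y-T\rangle-\beta_d(y,T)\}$, with maximizer $T_{i,y}(\lambda)$. The number $a_{i,k}(y)>0$ is the unique solution $a$ of $$\varphi_{i,y}\Big(\frac{a}{\gamma_{k+1}}\Big)=\Big(1-\frac{\gamma_k}{\gamma_{k+1}}\Big)D_0;$$ such solutions are assumed to exist. Switching Subgradient Method for Unbounded Sets: choose $x_0\in Q$. For $k\ge0$: (1) $\tau_k=\gamma_k/\gamma_{k+1}$, $y_k=(1-\tau_k)x_0+\tau_kx_k$.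 (2) If there is $i\in\{1,\dots,m\}$ with $f_i(y_k)\ge\epsilon$, set $i_k=i$ for such an $i$; otherwise set $i_k=0$. (3) $a_k=a_{i_k,k}(y_k)$ and $x_{k+1}=T_{i_k,y_k}(a_k/\gamma_{k+1})$. Further notation: $\mathcal{S}_i(N)=\{k:\ 0\le k\le N-1,\ i_k=i\}$ and $\hat\sigma_i(N)=\sum_{k\in\mathcal{S}_i(N)}a_k$ for $i=0,\dots,m$; $\hat\lambda_i(N)=\hat\sigma_i(N)/\hat\sigma_0(N)$ for $i=1,\dots,m$ (defined when $\hat\sigma_0(N)>0$), $\hat\lambda(N)=(\hat\lambda_1(N),\dots,\hat\lambda_m(N))^T$. $Q_D=\{x\in Q:\ \beta_d(x_0,x)\le D\}$ and $\phi_D(\lambda)=\min_{x\in Q_D}\{f_0(x)+\sum_{i=1}^m\lambda_if_i(x)\}$ for $\lambda\in\mathbb{R}^m_+$. *)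

theory Defs
  imports "HOL-Analysis.Analysis"
begin

text \<open>
  The space is a type of class \<open>real_normed_vector\<close>, so its norm is arbitrary; finite
  dimension is a separate predicate. The dual space is the type of bounded linear functionals,
  which in finite dimension are all the linear functionals. Its norm is the dual norm, as
  the lemma \<open>norm_blinfun_eq_dual_norm\<close> below shows.

  Minima and maxima of real functions over possibly infinite sets are written as \<open>INF\<close> and
  \<open>SUP\<close>. These are the values of the minima and maxima whenever those exist, which is the case
  for all sets and functions below under the hypotheses where they are used.
\<close>

definition finite_dimensional :: "'a::real_normed_vector itself \<Rightarrow> bool" where
  "finite_dimensional _ \<longleftrightarrow> (\<exists>B::'a set. finite B \<and> span B = UNIV)"

lemma norm_blinfun_eq_dual_norm:
  fixes g :: "'a::real_normed_vector \<Rightarrow>\<^sub>L real"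
  shows "norm g = (SUP x\<in>{x. norm x \<le> 1}. blinfun_apply g x)"
proof (rule antisym)
  let ?U = "{x::'a. norm x \<le> 1}"
  have le: "blinfun_apply g x \<le> norm g" if "norm x \<le> 1" for x
  proof -
    have "blinfun_apply g x \<le> norm g * norm x"
      using norm_blinfun[of g x] by simp
    also have "\<dots> \<le> norm g"
      using that by (simp add: mult_left_le)
    finally show ?thesis .
  qed
  have bdd: "bdd_above (blinfun_apply g ` ?U)"
    using le by (intro bdd_aboveI[of _ "norm g"]) auto
  have nonneg: "0 \<le> (SUP x\<in>?U. blinfun_apply g x)"
    using cSUP_upper[OF _ bdd, of 0] by simp
  have unit: "\<bar>blinfun_apply g x\<bar> \<le> (SUP x\<in>?U. blinfun_apply g x)" if "norm x \<le> 1" for x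
    using cSUP_upper[OF _ bdd, of x] cSUP_upper[OF _ bdd, of "- x"] that
    by (simp add: blinfun.minus_right abs_le_iff)
  show "norm g \<le> (SUP x\<in>?U. blinfun_apply g x)"
  proof (rule norm_blinfun_bound[OF nonneg])
    fix x :: 'a
    show "norm (blinfun_apply g x) \<le> (SUP x\<in>?U. blinfun_apply g x) * norm x"
    proof (cases "x = 0")
      case False
      then show ?thesis
        using unit[of "x /\<^sub>R norm x"]
        by (simp add: blinfun.scaleR_right abs_mult divide_simps mult.commute)
    qed simp
  qed
  show "(SUP x\<in>?U. blinfun_apply g x) \<le> norm g"
    by (rule cSUP_least) (auto intro: le exI[of _ 0])
qed

text \<open>\<open>g\<close> is a selection of subgradients on \<open>Q\<close>.\<close>

definition subgradient_selection ::
  "'a::real_normed_vector set \<Rightarrow> ('a \<Rightarrow> real) \<Rightarrow> ('a \<Rightarrow> 'a \<Rightarrow>\<^sub>L real) \<Rightarrow> bool" where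
  "subgradient_selection Q f g \<longleftrightarrow>
     (\<forall>x\<in>Q. \<forall>y\<in>Q. f y \<ge> f x + blinfun_apply (g x) (y - x))"

text \<open>Closedness of a convex function on \<open>Q\<close> means closedness of its epigraph over \<open>Q\<close>.\<close>

definition closed_convex_on :: "'a::real_normed_vector set \<Rightarrow> ('a \<Rightarrow> real) \<Rightarrow> bool" where
  "closed_convex_on Q f \<longleftrightarrow> convex_on Q f \<and> closed {(x, t). x \<in> Q \<and> f x \<le> t}"

definition bregman ::
  "('a::real_normed_vector \<Rightarrow> real) \<Rightarrow> ('a \<Rightarrow> 'a \<Rightarrow>\<^sub>L real) \<Rightarrow> 'a \<Rightarrow> 'a \<Rightarrow> real" where
  "bregman d d' x y = d y - d x - blinfun_apply (d' x) (y - x)"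

text \<open>The set \<open>X\<close> is the domain of the prox-function \<open>d\<close>, and \<open>d'\<close> is its gradient.\<close>

definition prox_function ::
  "'a::real_normed_vector set \<Rightarrow> 'a set \<Rightarrow> ('a \<Rightarrow> real) \<Rightarrow> ('a \<Rightarrow> 'a \<Rightarrow>\<^sub>L real) \<Rightarrow> bool" where
  "prox_function Q X d d' \<longleftrightarrow>
     open X \<and> convex X \<and> Q \<subseteq> X \<and>
     (\<forall>x\<in>X. (d has_derivative blinfun_apply (d' x)) (at x)) \<and>
     continuous_on X d' \<and>
     (\<forall>x\<in>X. \<forall>y\<in>X. d y \<ge> d x + blinfun_apply (d' x) (y - x) + 1/2 * (norm (y - x))\<^sup>2)"

text \<open>
  Objective of the maximization over \<open>T \<in> Q\<close> in a step with subgradient \<open>g\<close> at \<open>y\<close>, and its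
  optimal value \<open>\<phi>(l)\<close> for \<open>g = f\<^sub>i'(y)\<close>.
\<close>

definition step_objective ::
  "('a::real_normed_vector \<Rightarrow> real) \<Rightarrow> ('a \<Rightarrow> 'a \<Rightarrow>\<^sub>L real) \<Rightarrow> ('a \<Rightarrow>\<^sub>L real) \<Rightarrow> 'a \<Rightarrow> real \<Rightarrow> 'a \<Rightarrow> real"
  where
  "step_objective d d' g y l T = l * blinfun_apply g (y - T) - bregman d d' y T"

definition step_value ::
  "'a::real_normed_vector set \<Rightarrow> ('a \<Rightarrow> real) \<Rightarrow> ('a \<Rightarrow> 'a \<Rightarrow>\<^sub>L real) \<Rightarrow> ('a \<Rightarrow>\<^sub>L real) \<Rightarrow> 'a \<Rightarrow> real \<Rightarrow> real"
  where
  "step_value Q d d' g y l = (SUP T\<in>Q. step_objective d d' g y l T)"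

text \<open>
  The sequences \<open>x\<close>, \<open>y\<close>, \<open>idx\<close> (the indices \<open>i\<^sub>k\<close>) and \<open>a\<close> are produced by the switching
  subgradient method for unbounded sets. The constraint index may be any violated one.
  The existence of the positive root \<open>a k\<close> is part of the predicate. Its uniqueness is not
  required: \<open>step_value\<close> is convex and nonnegative in \<open>l\<close> and vanishes at \<open>0\<close>, so it takes each
  positive value at most once on \<open>l > 0\<close>. The maximizer \<open>x (Suc k)\<close> is unique by strong convexity.
\<close>

definition switching_subgradient_method ::
  "'a::real_normed_vector set \<Rightarrow> ('a \<Rightarrow> real) \<Rightarrow> ('a \<Rightarrow> 'a \<Rightarrow>\<^sub>L real) \<Rightarrow>
   nat \<Rightarrow> (nat \<Rightarrow> 'a \<Rightarrow> real) \<Rightarrow> (nat \<Rightarrow> 'a \<Rightarrow> 'a \<Rightarrow>\<^sub>L real) \<Rightarrow>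
   (nat \<Rightarrow> real) \<Rightarrow> real \<Rightarrow> real \<Rightarrow>
   (nat \<Rightarrow> 'a) \<Rightarrow> (nat \<Rightarrow> 'a) \<Rightarrow> (nat \<Rightarrow> nat) \<Rightarrow> (nat \<Rightarrow> real) \<Rightarrow> bool" where
  "switching_subgradient_method Q d d' m f f' \<gamma> D0 \<epsilon> x y idx a \<longleftrightarrow>
     x 0 \<in> Q \<and>
     (\<forall>k. let \<tau> = \<gamma> k / \<gamma> (Suc k); g = f' (idx k) (y k) in
        y k = (1 - \<tau>) *\<^sub>R x 0 + \<tau> *\<^sub>R x k \<and>
        (if \<exists>i\<in>{1..m}. f i (y k) \<ge> \<epsilon>
         then idx k \<in> {1..m} \<and> f (idx k) (y k) \<ge> \<epsilon>
         else idx k = 0) \<and>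
        a k > 0 \<and>
        step_value Q d d' g (y k) (a k / \<gamma> (Suc k)) = (1 - \<tau>) * D0 \<and>
        is_arg_max (step_objective d d' g (y k) (a k / \<gamma> (Suc k))) (\<lambda>T. T \<in> Q) (x (Suc k)))"

definition feasible_set :: "'a set \<Rightarrow> nat \<Rightarrow> (nat \<Rightarrow> 'a \<Rightarrow> real) \<Rightarrow> 'a set" where
  "feasible_set Q m f = {x \<in> Q. \<forall>i\<in>{1..m}. f i x \<le> 0}"

definition optimal_value :: "'a set \<Rightarrow> nat \<Rightarrow> (nat \<Rightarrow> 'a \<Rightarrow> real) \<Rightarrow> real" where
  "optimal_value Q m f = (INF x\<in>feasible_set Q m f. f 0 x)"

text \<open>
  The multipliers \<open>\<lambda>\<^sub>1, \<dots>, \<lambda>\<^sub>m\<close> are the values of a function on \<open>nat\<close> at \<open>1, \<dots>, m\<close>; the other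
  values are irrelevant.
\<close>

definition restricted_dual ::
  "'a::real_normed_vector set \<Rightarrow> ('a \<Rightarrow> real) \<Rightarrow> ('a \<Rightarrow> 'a \<Rightarrow>\<^sub>L real) \<Rightarrow>
   nat \<Rightarrow> (nat \<Rightarrow> 'a \<Rightarrow> real) \<Rightarrow> 'a \<Rightarrow> real \<Rightarrow> (nat \<Rightarrow> real) \<Rightarrow> real" where
  "restricted_dual Q d d' m f x0 D \<mu> =
     (INF x\<in>{x \<in> Q. bregman d d' x0 x \<le> D}. f 0 x + (\<Sum>i=1..m. \<mu> i * f i x))"

definition steps_with_index :: "(nat \<Rightarrow> nat) \<Rightarrow> nat \<Rightarrow> nat \<Rightarrow> nat set" where
  "steps_with_index idx i N = {k. k < N \<and> idx k = i}"

definition sigma_hat :: "(nat \<Rightarrow> nat) \<Rightarrow> (nat \<Rightarrow> real) \<Rightarrow> nat \<Rightarrow> nat \<Rightarrow> real" where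
  "sigma_hat idx a i N = (\<Sum>k\<in>steps_with_index idx i N. a k)"

definition lambda_hat :: "(nat \<Rightarrow> nat) \<Rightarrow> (nat \<Rightarrow> real) \<Rightarrow> nat \<Rightarrow> nat \<Rightarrow> real" where
  "lambda_hat idx a N i = sigma_hat idx a i N / sigma_hat idx a 0 N"

text \<open>Used only when \<open>steps_with_index idx 0 N\<close> is nonempty.\<close>

definition best_value ::
  "(nat \<Rightarrow> 'a \<Rightarrow> real) \<Rightarrow> (nat \<Rightarrow> 'a) \<Rightarrow> (nat \<Rightarrow> nat) \<Rightarrow> nat \<Rightarrow> real" where
  "best_value f y idx N = Min ((\<lambda>k. f 0 (y k)) ` steps_with_index idx 0 N)"

definition coeff_sum :: "(nat \<Rightarrow> real) \<Rightarrow> nat \<Rightarrow> real" where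
  "coeff_sum \<gamma> N = 1 / \<gamma> N * (\<Sum>k<N. sqrt (\<gamma> (Suc k) * (\<gamma> (Suc k) - \<gamma> k)))"

end

theory Submission
  imports Defs
begin

text \<open>
  The optimality condition of the maximization in each step, together with the three-point identity
  for the Bregman distance and its convexity in the first argument, gives for every \<open>u \<in> Q\<close>
  \<open>\<gamma>\<^bsub>k+1\<^esub> \<beta>(x\<^bsub>k+1\<^esub>,u) + a\<^sub>k \<langle>g\<^sub>k, y\<^sub>k - u\<rangle>
    \<le> \<gamma>\<^sub>k \<beta>(x\<^sub>k,u) + (\<gamma>\<^bsub>k+1\<^esub> - \<gamma>\<^sub>k) (\<beta>(x\<^sub>0,u) + D\<^sub>0)\<close>.
  Summing up, \<open>\<Sum>\<^sub>k a\<^sub>k \<langle>g\<^sub>k, y\<^sub>k - u\<rangle> \<le> \<gamma>\<^sub>N (\<beta>(x\<^sub>0,u) + D\<^sub>0)\<close>. On the other hand strong convexity bounds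
  the step value by \<open>(a\<^sub>k M / \<gamma>\<^bsub>k+1\<^esub>)\<^sup>2 / 2\<close>, so the equation defining \<open>a\<^sub>k\<close> forces the \<open>a\<^sub>k\<close> to be large:
  \<open>M \<Sum>\<^sub>k a\<^sub>k \<ge> sqrt (2 D\<^sub>0) \<gamma>\<^sub>N \<Sigma>\<^sub>N\<close>. Step \<open>k\<close> contributes at least
  \<open>a\<^sub>k (f\<^sub>i(y\<^sub>k) - f\<^sub>i(u))\<close> with \<open>i = i\<^sub>k\<close> to the first sum, where \<open>f\<^sub>i(y\<^sub>k) \<ge> \<epsilon>\<close> for constraint steps; comparing the
  two bounds gives the first claim for \<open>u \<in> \<F>\<close> and the second for \<open>u \<in> Q\<^sub>D\<close>.
\<close>

section \<open>Bregman distances and a single maximization step\<close>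

lemma bregman_ge_norm:
  assumes "prox_function Q X d d'" "u \<in> Q" "v \<in> Q"
  shows "(norm (v - u))\<^sup>2 / 2 \<le> bregman d d' u v"
proof -
  have "u \<in> X" "v \<in> X"
    using assms by (auto simp: prox_function_def)
  then have "d v \<ge> d u + blinfun_apply (d' u) (v - u) + 1/2 * (norm (v - u))\<^sup>2"
    using assms(1) unfolding prox_function_def by blast
  then show ?thesis
    by (simp add: bregman_def)
qed

lemma bregman_nonneg:
  assumes "prox_function Q X d d'" "u \<in> Q" "v \<in> Q"
  shows "0 \<le> bregman d d' u v"
  using bregman_ge_norm[OF assms] by (rule order_trans[rotated]) simp

lemma bregman_three_point:
  "bregman d d' y u - bregman d d' T u - bregman d d' y T
     = blinfun_apply (d' T) (u - T) - blinfun_apply (d' y) (u - T)"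
  unfolding bregman_def by (simp add: blinfun.diff_right algebra_simps)

lemma step_value_eq_arg_max:
  assumes "is_arg_max (step_objective d d' g y l) (\<lambda>T. T \<in> Q) T"
  shows "step_value Q d d' g y l = step_objective d d' g y l T"
  unfolding step_value_def
  by (rule cSup_eq_maximum) (use assms in \<open>auto simp: is_arg_max_linorder\<close>)

text \<open>The linear term is at most \<open>l * M * norm (y - T)\<close>. Young's inequality
  splits this product, and the quadratic part in \<open>norm (y - T)\<close> is absorbed by the
  strong convexity of \<open>d\<close>.\<close>

lemma step_objective_le:
  assumes "prox_function Q X d d'" "y \<in> Q" "T \<in> Q" "l \<ge> 0" "norm g \<le> M"
  shows "step_objective d d' g y l T \<le> (l * M)\<^sup>2 / 2"
proof -
  have "l * blinfun_apply g (y - T) \<le> l * (M * norm (y - T))"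
  proof (rule mult_left_mono)
    have "blinfun_apply g (y - T) \<le> norm g * norm (y - T)"
      using norm_blinfun[of g "y - T"] by simp
    also have "\<dots> \<le> M * norm (y - T)"
      using assms(5) by (rule mult_right_mono) simp
    finally show "blinfun_apply g (y - T) \<le> M * norm (y - T)" .
  qed fact
  moreover have "(norm (y - T))\<^sup>2 / 2 \<le> bregman d d' y T"
    using bregman_ge_norm[OF assms(1-3)] by (simp add: norm_minus_commute)
  moreover have "(l * M)\<^sup>2 + (norm (y - T))\<^sup>2 \<ge> 2 * (l * (M * norm (y - T)))"
    using sum_squares_bound[of "l * M" "norm (y - T)"] by (simp add: mult.assoc)
  ultimately show ?thesis
    by (simp add: step_objective_def)
qed

text \<open>First-order condition along the segment from \<open>T\<close> to \<open>u\<close>: a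
  negative slope at \<open>T\<close> would make the negated objective smaller at a nearby point of
  \<open>Q\<close>.\<close>

lemma arg_max_optimality:
  assumes prox: "prox_function Q X d d'" and "convex Q" "u \<in> Q"
    and max: "is_arg_max (step_objective d d' g y l) (\<lambda>T. T \<in> Q) T"
  shows "0 \<le> l * blinfun_apply g (u - T) + blinfun_apply (d' T) (u - T) - blinfun_apply (d' y) (u - T)"
    (is "0 \<le> ?s")
proof (rule ccontr)
  assume "\<not> 0 \<le> ?s"
  have T: "T \<in> Q"
    using max by (simp add: is_arg_max_def)
  define F where "F t = - step_objective d d' g y l (T + t *\<^sub>R (u - T))" for t
  \<comment> \<open>Apart from the \<open>d\<close> term, \<open>F\<close> is affine in
    \<open>t\<close>, so only the chain rule for \<open>d\<close> remains. As \<open>d\<close> is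
    differentiable at \<open>T\<close> in the whole space, points with \<open>t < 0\<close> outside
    \<open>Q\<close> do no harm.\<close>
  have F_eq: "F = (\<lambda>t. l * (blinfun_apply g (T - y) + t * blinfun_apply g (u - T))
      + (d (T + t *\<^sub>R (u - T)) - d y - (blinfun_apply (d' y) (T - y) + t * blinfun_apply (d' y) (u - T))))"
    by (rule ext)
       (simp add: F_def step_objective_def bregman_def blinfun.diff_right blinfun.add_right
         blinfun.scaleR_right algebra_simps)
  have "(d has_derivative blinfun_apply (d' T)) (at T)"
    using prox T by (auto simp: prox_function_def)
  moreover have "((\<lambda>t. T + t *\<^sub>R (u - T)) has_derivative (\<lambda>t. t *\<^sub>R (u - T))) (at 0)"
    by (auto intro!: derivative_eq_intros)
  ultimately have "((\<lambda>t. d (T + t *\<^sub>R (u - T))) has_derivative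
      (\<lambda>t. blinfun_apply (d' T) (t *\<^sub>R (u - T)))) (at (0::real))"
    by (auto intro: has_derivative_compose)
  then have "((\<lambda>t. d (T + t *\<^sub>R (u - T))) has_real_derivative blinfun_apply (d' T) (u - T)) (at 0)"
    by (simp add: has_field_derivative_def blinfun.scaleR_right mult_commute_abs)
  then have "(F has_real_derivative ?s) (at 0)"
    unfolding F_eq by (auto intro!: derivative_eq_intros)
  with \<open>\<not> 0 \<le> ?s\<close> obtain e where e: "e > 0" "\<And>h. h > 0 \<Longrightarrow> h < e \<Longrightarrow> F h < F 0"
    using DERIV_neg_dec_right[of F ?s 0] by auto
  \<comment> \<open>Small enough for the strict decrease, and at most 1 so that the point stays on
    the segment inside \<open>Q\<close>.\<close>
  define h where "h = min (e / 2) 1"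
  have h: "0 < h" "h < e" "h \<le> 1"
    using e(1) by (auto simp: h_def)
  have "T + h *\<^sub>R (u - T) = (1 - h) *\<^sub>R T + h *\<^sub>R u"
    by (simp add: algebra_simps)
  also have "\<dots> \<in> Q"
    using convexD_alt[OF \<open>convex Q\<close> T \<open>u \<in> Q\<close>] h by simp
  finally have "F 0 \<le> F h"
    using max by (simp add: F_def is_arg_max_linorder)
  with e(2)[of h] h show False
    by simp
qed

text \<open>The three-point identity turns the gradient differences in the optimality condition into
  Bregman distances; the remaining terms at \<open>T\<close> form the step value.\<close>

lemma bregman_arg_max_le:
  assumes "prox_function Q X d d'" "convex Q" "u \<in> Q"
    and "is_arg_max (step_objective d d' g y l) (\<lambda>T. T \<in> Q) T"
  shows "bregman d d' T u \<le> bregman d d' y u + step_value Q d d' g y l + l * blinfun_apply g (u - y)"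
  using arg_max_optimality[OF assms] bregman_three_point[of d d' y u T]
  unfolding step_value_eq_arg_max[OF assms(4)] step_objective_def
  by (simp add: blinfun.diff_right algebra_simps)

section \<open>Estimates along a run of the method\<close>

locale switching_subgradient_run =
  fixes Q X :: "'a::real_normed_vector set"
    and d :: "'a \<Rightarrow> real" and d' :: "'a \<Rightarrow> 'a \<Rightarrow>\<^sub>L real"
    and m :: nat
    and f :: "nat \<Rightarrow> 'a \<Rightarrow> real" and f' :: "nat \<Rightarrow> 'a \<Rightarrow> 'a \<Rightarrow>\<^sub>L real"
    and \<gamma> a :: "nat \<Rightarrow> real" and D0 M \<epsilon> :: real
    and x y :: "nat \<Rightarrow> 'a" and idx :: "nat \<Rightarrow> nat"
  assumes Q_convex: "convex Q"
    and subgrad: "\<And>i. i \<le> m \<Longrightarrow> subgradient_selection Q (f i) (f' i)"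
    and prox: "prox_function Q X d d'"
    and bregman_convex: "\<And>z. z \<in> Q \<Longrightarrow> convex_on Q (\<lambda>u. bregman d d' u z)"
    and M_pos: "M > 0"
    and subgrad_bound: "\<And>i z. i \<le> m \<Longrightarrow> z \<in> Q \<Longrightarrow> norm (f' i z) \<le> M"
    and eps_pos: "\<epsilon> > 0" and D0_pos: "D0 > 0"
    and gamma_nonneg: "\<And>k. \<gamma> k \<ge> 0" and gamma_less: "\<And>k. \<gamma> (Suc k) > \<gamma> k"
    and run: "switching_subgradient_method Q d d' m f f' \<gamma> D0 \<epsilon> x y idx a"
begin

abbreviation g where "g k \<equiv> f' (idx k) (y k)"

lemma gamma_Suc_pos: "\<gamma> (Suc k) > 0"
  using gamma_nonneg[of k] gamma_less[of k] by simp

lemma gamma_pos: "N \<ge> 1 \<Longrightarrow> \<gamma> N > 0"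
  using gamma_Suc_pos[of "N - 1"] by simp

lemma ratio_bounds: "0 \<le> \<gamma> k / \<gamma> (Suc k)" "\<gamma> k / \<gamma> (Suc k) \<le> 1"
  using gamma_nonneg[of k] gamma_less[of k] gamma_Suc_pos[of k] by auto

lemma y_eq: "y k = (1 - \<gamma> k / \<gamma> (Suc k)) *\<^sub>R x 0 + (\<gamma> k / \<gamma> (Suc k)) *\<^sub>R x k"
  and a_pos: "a k > 0"
  and step_value_eq: "step_value Q d d' (g k) (y k) (a k / \<gamma> (Suc k)) = (1 - \<gamma> k / \<gamma> (Suc k)) * D0"
  and x_Suc: "is_arg_max (step_objective d d' (g k) (y k) (a k / \<gamma> (Suc k))) (\<lambda>T. T \<in> Q) (x (Suc k))"
  using run unfolding switching_subgradient_method_def Let_def by blast+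

lemma idx_le: "idx k \<le> m"
  and violated: "idx k \<noteq> 0 \<Longrightarrow> f (idx k) (y k) \<ge> \<epsilon>"
  using run unfolding switching_subgradient_method_def Let_def
  by (metis atLeastAtMost_iff zero_le)+

lemma x_in: "x k \<in> Q"
proof (cases k)
  case 0
  then show ?thesis
    using run by (simp add: switching_subgradient_method_def)
next
  case (Suc j)
  then show ?thesis
    using x_Suc[of j] by (simp add: is_arg_max_def)
qed

lemma y_in: "y k \<in> Q"
  unfolding y_eq using convexD_alt[OF Q_convex x_in[of 0] x_in[of k]] ratio_bounds by blast

lemma subgradient_le:
  assumes "u \<in> Q"
  shows "f (idx k) (y k) - f (idx k) u \<le> blinfun_apply (g k) (y k - u)"
proof -
  have "f (idx k) u \<ge> f (idx k) (y k) + blinfun_apply (g k) (u - y k)"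
    using subgrad[OF idx_le] y_in assms by (simp add: subgradient_selection_def)
  then show ?thesis
    by (simp add: blinfun.diff_right)
qed

lemma bregman_step:
  assumes u: "u \<in> Q"
  shows "\<gamma> (Suc k) * bregman d d' (x (Suc k)) u + a k * blinfun_apply (g k) (y k - u)
    \<le> \<gamma> k * bregman d d' (x k) u + (\<gamma> (Suc k) - \<gamma> k) * (bregman d d' (x 0) u + D0)"
proof -
  let ?\<tau> = "\<gamma> k / \<gamma> (Suc k)" and ?l = "a k / \<gamma> (Suc k)" and ?G = "\<gamma> (Suc k)"
  \<comment> \<open>Convexity in the first argument, applied to the convex combination
    \<open>y k\<close> of \<open>x 0\<close> and \<open>x k\<close>.\<close>
  have "bregman d d' (y k) u \<le> (1 - ?\<tau>) * bregman d d' (x 0) u + ?\<tau> * bregman d d' (x k) u"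
    unfolding y_eq
    using convex_onD[OF bregman_convex[OF u] ratio_bounds x_in x_in] .
  then have "bregman d d' (x (Suc k)) u \<le> (1 - ?\<tau>) * bregman d d' (x 0) u
      + ?\<tau> * bregman d d' (x k) u + (1 - ?\<tau>) * D0 + ?l * blinfun_apply (g k) (u - y k)"
    using bregman_arg_max_le[OF prox Q_convex u x_Suc[of k]] unfolding step_value_eq by simp
  \<comment> \<open>Scaling by \<open>\<gamma> (Suc k)\<close> clears the ratios and makes the
    estimate telescope in \<open>k\<close>.\<close>
  then have "?G * bregman d d' (x (Suc k)) u \<le> ?G * ((1 - ?\<tau>) * bregman d d' (x 0) u
      + ?\<tau> * bregman d d' (x k) u + (1 - ?\<tau>) * D0 + ?l * blinfun_apply (g k) (u - y k))"
    using gamma_Suc_pos[of k] by (intro mult_left_mono) auto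
  also have "\<dots> = (?G - \<gamma> k) * (bregman d d' (x 0) u + D0) + \<gamma> k * bregman d d' (x k) u
      - a k * blinfun_apply (g k) (y k - u)"
    using gamma_Suc_pos[of k] by (simp add: blinfun.diff_right field_simps)
  finally show ?thesis
    by simp
qed

lemma weighted_subgradients_le:
  assumes u: "u \<in> Q"
  shows "(\<Sum>k<N. a k * blinfun_apply (g k) (y k - u)) \<le> \<gamma> N * (bregman d d' (x 0) u + D0)"
proof -
  \<comment> \<open>The induction carries the distance from \<open>x N\<close>, which is nonnegative
    and is dropped afterwards.\<close>
  have "\<gamma> N * bregman d d' (x N) u + (\<Sum>k<N. a k * blinfun_apply (g k) (y k - u))
      \<le> \<gamma> N * (bregman d d' (x 0) u + D0)"
  proof (induction N)
    case 0
    then show ?case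
      using gamma_nonneg[of 0] D0_pos by (simp add: algebra_simps)
  next
    case (Suc N)
    then show ?case
      using bregman_step[OF u, of N] by (simp add: algebra_simps)
  qed
  moreover have "0 \<le> \<gamma> N * bregman d d' (x N) u"
    using gamma_nonneg bregman_nonneg[OF prox x_in u] by simp
  ultimately show ?thesis
    by linarith
qed

lemma a_lower_bound: "sqrt (2 * D0) * sqrt (\<gamma> (Suc k) * (\<gamma> (Suc k) - \<gamma> k)) \<le> M * a k"
proof -
  let ?l = "a k / \<gamma> (Suc k)" and ?G = "\<gamma> (Suc k)"
  have "?l \<ge> 0"
    using a_pos[of k] gamma_Suc_pos[of k] by simp
  then have "(1 - \<gamma> k / ?G) * D0 \<le> (?l * M)\<^sup>2 / 2"
    using step_objective_le[OF prox y_in x_in _ subgrad_bound[OF idx_le y_in]]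
      step_value_eq_arg_max[OF x_Suc[of k]]
    unfolding step_value_eq by metis
  \<comment> \<open>The factor clears all denominators, leaving \<open>(M * a k)\<^sup>2\<close> on
    the right, ready for a square root.\<close>
  then have "2 * ?G\<^sup>2 * ((1 - \<gamma> k / ?G) * D0) \<le> 2 * ?G\<^sup>2 * ((?l * M)\<^sup>2 / 2)"
    by (intro mult_left_mono) auto
  also have "2 * ?G\<^sup>2 * ((1 - \<gamma> k / ?G) * D0) = 2 * D0 * (?G * (?G - \<gamma> k))"
    using gamma_Suc_pos[of k] by (simp add: power2_eq_square field_simps)
  also have "2 * ?G\<^sup>2 * ((?l * M)\<^sup>2 / 2) = (M * a k)\<^sup>2"
    using gamma_Suc_pos[of k] by (simp add: power2_eq_square field_simps)
  finally have "2 * D0 * (?G * (?G - \<gamma> k)) \<le> (M * a k)\<^sup>2" .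
  then have "sqrt (2 * D0 * (?G * (?G - \<gamma> k))) \<le> M * a k"
    using M_pos a_pos[of k] by (intro real_le_lsqrt) auto
  then show ?thesis
    by (simp add: real_sqrt_mult)
qed

lemma sum_a_lower_bound:
  assumes "N \<ge> 1"
  shows "sqrt (2 * D0) * (\<gamma> N * coeff_sum \<gamma> N) \<le> M * (\<Sum>k<N. a k)"
proof -
  have "sqrt (2 * D0) * (\<gamma> N * coeff_sum \<gamma> N)
      = (\<Sum>k<N. sqrt (2 * D0) * sqrt (\<gamma> (Suc k) * (\<gamma> (Suc k) - \<gamma> k)))"
    using gamma_pos[OF assms] by (simp add: coeff_sum_def sum_distrib_left)
  also have "\<dots> \<le> M * (\<Sum>k<N. a k)"
    unfolding sum_distrib_left by (intro sum_mono a_lower_bound)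
  finally show ?thesis .
qed

text \<open>Serves both thresholds: \<open>r\<close> is the minimal distance to the feasible set for
  the first claim and \<open>D\<close> for the second.\<close>

lemma coeff_sum_imp_sum_a_large:
  assumes "N \<ge> 1" "coeff_sum \<gamma> N > (r + D0) / sqrt (2 * D0) * (M / \<epsilon>)"
  shows "\<gamma> N * (r + D0) < \<epsilon> * (\<Sum>k<N. a k)"
proof -
  have "M * (r + D0) < \<epsilon> * (sqrt (2 * D0) * coeff_sum \<gamma> N)"
    using assms(2) eps_pos D0_pos by (simp add: field_simps)
  then have "\<gamma> N * (M * (r + D0)) < \<gamma> N * (\<epsilon> * (sqrt (2 * D0) * coeff_sum \<gamma> N))"
    using gamma_pos[OF assms(1)] by (rule mult_strict_left_mono)
  also have "\<dots> = \<epsilon> * (sqrt (2 * D0) * (\<gamma> N * coeff_sum \<gamma> N))"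
    by simp
  also have "\<dots> \<le> \<epsilon> * (M * (\<Sum>k<N. a k))"
    using eps_pos by (intro mult_left_mono sum_a_lower_bound assms(1)) auto
  finally have "M * (\<gamma> N * (r + D0)) < M * (\<epsilon> * (\<Sum>k<N. a k))"
    by (simp add: algebra_simps)
  then show ?thesis
    using M_pos by simp
qed

section \<open>Objective steps, multipliers and the Lagrangian bound\<close>

lemma finite_steps [simp]: "finite (steps_with_index idx i N)"
  by (simp add: steps_with_index_def)

lemma steps_nonempty:
  assumes "N \<ge> 1" "feasible_set Q m f \<noteq> {}"
    and "coeff_sum \<gamma> N > ((INF z\<in>feasible_set Q m f. bregman d d' (x 0) z) + D0)
      / sqrt (2 * D0) * (M / \<epsilon>)"
  shows "steps_with_index idx 0 N \<noteq> {}"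
proof
  let ?S = "\<Sum>k<N. a k"
  assume "steps_with_index idx 0 N = {}"
  then have idx: "idx k \<noteq> 0" if "k < N" for k
    using that by (auto simp: steps_with_index_def)
  \<comment> \<open>If every step is a constraint step, each contributes at least
    \<open>\<epsilon> * a k\<close>. Solving for the distance gives a bound uniform in
    \<open>u\<close>, which passes to the infimum.\<close>
  have "\<epsilon> * ?S / \<gamma> N - D0 \<le> bregman d d' (x 0) u" if u: "u \<in> feasible_set Q m f" for u
  proof -
    have uQ: "u \<in> Q"
      using u by (simp add: feasible_set_def)
    have "\<epsilon> * ?S \<le> (\<Sum>k<N. a k * blinfun_apply (g k) (y k - u))"
      unfolding sum_distrib_left
    proof (rule sum_mono)
      fix k assume "k \<in> {..<N}"
      then have "idx k \<noteq> 0"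
        using idx by simp
      moreover from this have "f (idx k) u \<le> 0"
        using u idx_le[of k] by (auto simp: feasible_set_def)
      ultimately have "\<epsilon> \<le> blinfun_apply (g k) (y k - u)"
        using violated[of k] subgradient_le[OF uQ, of k] by linarith
      then show "\<epsilon> * a k \<le> a k * blinfun_apply (g k) (y k - u)"
        using a_pos[of k] by (simp add: mult.commute)
    qed
    also have "\<dots> \<le> \<gamma> N * (bregman d d' (x 0) u + D0)"
      by (rule weighted_subgradients_le[OF uQ])
    finally show ?thesis
      using gamma_pos[OF assms(1)] by (simp add: field_simps)
  qed
  then have "\<epsilon> * ?S / \<gamma> N - D0 \<le> (INF z\<in>feasible_set Q m f. bregman d d' (x 0) z)"
    using assms(2) by (intro cINF_greatest)
  then have "\<epsilon> * ?S \<le> \<gamma> N * ((INF z\<in>feasible_set Q m f. bregman d d' (x 0) z) + D0)"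
    using gamma_pos[OF assms(1)] by (simp add: field_simps)
  then show False
    using coeff_sum_imp_sum_a_large[OF assms(1,3)] by linarith
qed

lemma sigma_hat_nonneg: "sigma_hat idx a i N \<ge> 0"
  unfolding sigma_hat_def by (intro sum_nonneg less_imp_le a_pos)

lemma sigma_hat_pos:
  assumes "steps_with_index idx 0 N \<noteq> {}"
  shows "sigma_hat idx a 0 N > 0"
  unfolding sigma_hat_def using assms by (intro sum_pos a_pos) auto

lemma sum_by_index: "(\<Sum>k<N. a k * h (idx k)) = (\<Sum>i\<le>m. sigma_hat idx a i N * h i)"
proof -
  have "(\<Sum>k<N. a k * h (idx k)) = (\<Sum>i\<le>m. \<Sum>k\<in>{k\<in>{..<N}. idx k = i}. a k * h (idx k))"
    by (rule sum.group[symmetric]) (auto simp: idx_le)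
  also have "\<dots> = (\<Sum>i\<le>m. sigma_hat idx a i N * h i)"
    by (intro sum.cong) (auto simp: sigma_hat_def steps_with_index_def sum_distrib_right)
  finally show ?thesis .
qed

lemma best_value_le_lagrangian:
  assumes N: "N \<ge> 1" and u: "u \<in> Q" "bregman d d' (x 0) u \<le> D"
    and ne: "steps_with_index idx 0 N \<noteq> {}"
    and large: "coeff_sum \<gamma> N > (D + D0) / sqrt (2 * D0) * (M / \<epsilon>)"
  shows "best_value f y idx N - \<epsilon> \<le> f 0 u + (\<Sum>i=1..m. lambda_hat idx a N i * f i u)"
proof -
  let ?s = "\<lambda>i. sigma_hat idx a i N" and ?b = "best_value f y idx N" and ?S = "\<Sum>k<N. a k"
  \<comment> \<open>A lower bound for \<open>f i (y k)\<close> at every step \<open>k < N\<close>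
    with index \<open>i\<close>, depending on \<open>i\<close> only, so that the sum over steps can
    be grouped by index.\<close>
  define c where "c i = (if i = 0 then ?b else \<epsilon>)" for i :: nat
  have pos: "?s 0 > 0"
    by (rule sigma_hat_pos[OF ne])
  have split0: "(\<Sum>i\<le>m. h i) = h 0 + (\<Sum>i=1..m. h i)" for h :: "nat \<Rightarrow> real"
    by (simp add: atMost_atLeast0 sum.atLeast_Suc_atMost)
  have "(\<Sum>i\<le>m. ?s i * (c i - f i u)) = (\<Sum>k<N. a k * (c (idx k) - f (idx k) u))"
    by (rule sum_by_index[symmetric])
  also have "\<dots> \<le> (\<Sum>k<N. a k * blinfun_apply (g k) (y k - u))"
  proof (intro sum_mono mult_left_mono)
    fix k assume k: "k \<in> {..<N}"
    have "c (idx k) \<le> f (idx k) (y k)"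
    proof (cases "idx k = 0")
      case True
      then have "k \<in> steps_with_index idx 0 N"
        using k by (simp add: steps_with_index_def)
      then show ?thesis
        using True by (simp add: c_def best_value_def)
    qed (simp add: c_def violated)
    then show "c (idx k) - f (idx k) u \<le> blinfun_apply (g k) (y k - u)"
      using subgradient_le[OF u(1), of k] by linarith
    show "0 \<le> a k"
      using a_pos[of k] by simp
  qed
  also have "\<dots> \<le> \<gamma> N * (bregman d d' (x 0) u + D0)"
    by (rule weighted_subgradients_le[OF u(1)])
  also have "\<dots> \<le> \<gamma> N * (D + D0)"
    using u(2) gamma_nonneg by (intro mult_left_mono) auto
  also have "\<dots> \<le> \<epsilon> * ?S"
    using coeff_sum_imp_sum_a_large[OF N large] by simp
  also have "?S = (\<Sum>i\<le>m. ?s i)"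
    using sum_by_index[of "\<lambda>_. 1" N] by simp
  finally have "?s 0 * (?b - f 0 u) + (\<Sum>i=1..m. ?s i * (\<epsilon> - f i u))
      \<le> \<epsilon> * (?s 0 + (\<Sum>i=1..m. ?s i))"
    unfolding split0 by (simp add: c_def)
  \<comment> \<open>The \<epsilon>-terms of the constraint indices cancel; only the one of index 0
    survives, and division by \<open>?s 0\<close> produces the multipliers.\<close>
  then have "?s 0 * (?b - \<epsilon>) \<le> ?s 0 * f 0 u + (\<Sum>i=1..m. ?s i * f i u)"
    by (simp add: algebra_simps sum_subtractf sum_distrib_left)
  also have "\<dots> = ?s 0 * (f 0 u + (\<Sum>i=1..m. lambda_hat idx a N i * f i u))"
    using pos by (simp add: lambda_hat_def distrib_left sum_distrib_left)
  finally show ?thesis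
    using pos by simp
qed

end

section \<open>Optimal value and duality gap\<close>

lemma optimal_value_eq:
  assumes "is_arg_min (f 0) (\<lambda>z. z \<in> feasible_set Q m f) x_opt"
  shows "optimal_value Q m f = f 0 x_opt"
  unfolding optimal_value_def
  by (rule cInf_eq_minimum) (use assms in \<open>auto simp: is_arg_min_linorder\<close>)

theorem theorem7:
  fixes Q X :: "'a::real_normed_vector set"
    and d :: "'a \<Rightarrow> real" and d' :: "'a \<Rightarrow> 'a \<Rightarrow>\<^sub>L real"
    and m N :: nat
    and f :: "nat \<Rightarrow> 'a \<Rightarrow> real" and f' :: "nat \<Rightarrow> 'a \<Rightarrow> 'a \<Rightarrow>\<^sub>L real"
    and \<gamma> a :: "nat \<Rightarrow> real" and D D0 M \<epsilon> \<rho>0 :: real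
    and x y :: "nat \<Rightarrow> 'a" and idx :: "nat \<Rightarrow> nat" and x_opt :: 'a
  assumes "finite_dimensional TYPE('a)"
    and "closed Q" and "convex Q"
    and "\<And>i. i \<le> m \<Longrightarrow> closed_convex_on Q (f i)"
    and "\<And>i. i \<le> m \<Longrightarrow> subgradient_selection Q (f i) (f' i)"
    and "prox_function Q X d d'"
    and "\<And>z. z \<in> Q \<Longrightarrow> convex_on Q (\<lambda>u. bregman d d' u z)"
    and "is_arg_min (f 0) (\<lambda>z. z \<in> feasible_set Q m f) x_opt"
    and "D \<ge> bregman d d' (x 0) x_opt"
    and "M > 0" and "\<And>i z. i \<le> m \<Longrightarrow> z \<in> Q \<Longrightarrow> norm (f' i z) \<le> M"
    and "\<epsilon> > 0" and "D0 > 0"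
    and "\<And>k. \<gamma> k \<ge> 0" and "\<And>k. \<gamma> (Suc k) > \<gamma> k"
    and "switching_subgradient_method Q d d' m f f' \<gamma> D0 \<epsilon> x y idx a"
    and "N \<ge> 1"
    and "\<rho>0 = (INF z\<in>feasible_set Q m f. bregman d d' (x 0) z)"
  shows "(coeff_sum \<gamma> N > (\<rho>0 + D0) / sqrt (2 * D0) * (M / \<epsilon>) \<longrightarrow>
            steps_with_index idx 0 N \<noteq> {} \<and> sigma_hat idx a 0 N > 0) \<and>
         (coeff_sum \<gamma> N > (D + D0) / sqrt (2 * D0) * (M / \<epsilon>) \<longrightarrow>
            best_value f y idx N - optimal_value Q m f
              \<le> best_value f y idx N - restricted_dual Q d d' m f (x 0) D (lambda_hat idx a N) \<and>
            best_value f y idx N - restricted_dual Q d d' m f (x 0) D (lambda_hat idx a N) \<le> \<epsilon>)"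
proof -
  interpret switching_subgradient_run Q X d d' m f f' \<gamma> a D0 M \<epsilon> x y idx
    by unfold_locales (fact assms)+
  let ?F = "feasible_set Q m f" and ?L = "\<lambda>u. f 0 u + (\<Sum>i=1..m. lambda_hat idx a N i * f i u)"
    and ?b = "best_value f y idx N" and ?dual = "restricted_dual Q d d' m f (x 0) D (lambda_hat idx a N)"
  have opt: "x_opt \<in> ?F"
    using assms(8) by (simp add: is_arg_min_def)
  then have opt_Q: "x_opt \<in> {u \<in> Q. bregman d d' (x 0) u \<le> D}"
    using assms(9) by (simp add: feasible_set_def)
  have part1: "steps_with_index idx 0 N \<noteq> {}"
    if "coeff_sum \<gamma> N > (\<rho>0 + D0) / sqrt (2 * D0) * (M / \<epsilon>)"
    using steps_nonempty[OF assms(17)] opt that unfolding assms(18) by blast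
  have part2: "?b - optimal_value Q m f \<le> ?b - ?dual \<and> ?b - ?dual \<le> \<epsilon>"
    if large: "coeff_sum \<gamma> N > (D + D0) / sqrt (2 * D0) * (M / \<epsilon>)"
  proof -
    have "bdd_below (bregman d d' (x 0) ` ?F)"
      by (rule bdd_belowI[of _ 0])
         (auto simp: feasible_set_def intro: bregman_nonneg[OF prox x_in])
    \<comment> \<open>Bounded below, the infimum is at most the distance to the feasible point
      \<open>x_opt\<close>. Hence the second threshold implies the first.\<close>
    then have "\<rho>0 \<le> D"
      unfolding assms(18) using cINF_lower[OF _ opt] assms(9) by (metis order_trans)
    then have "(\<rho>0 + D0) / sqrt (2 * D0) * (M / \<epsilon>) \<le> (D + D0) / sqrt (2 * D0) * (M / \<epsilon>)"
      using D0_pos M_pos eps_pos by (intro mult_right_mono divide_right_mono) auto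
    then have ne: "steps_with_index idx 0 N \<noteq> {}"
      using part1 large by linarith
    \<comment> \<open>Used twice: it bounds the Lagrangian below, so that its infimum is at most its
      value at \<open>x_opt\<close>, and it bounds the infimum itself for the gap estimate.\<close>
    have lagr: "?b - \<epsilon> \<le> ?L u" if "u \<in> {u \<in> Q. bregman d d' (x 0) u \<le> D}" for u
      using best_value_le_lagrangian[OF assms(17) _ _ ne large] that by blast
    have "?dual \<le> ?L x_opt"
      unfolding restricted_dual_def
      by (rule cINF_lower[OF bdd_belowI2[OF lagr] opt_Q])
    \<comment> \<open>Weak duality: nonnegative multipliers meet nonpositive constraint
      values.\<close>
    also have "\<dots> \<le> f 0 x_opt"
    proof -
      have "lambda_hat idx a N i * f i x_opt \<le> 0" if "i \<in> {1..m}" for i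
      proof (rule mult_nonneg_nonpos)
        show "0 \<le> lambda_hat idx a N i"
          by (simp add: lambda_hat_def sigma_hat_nonneg)
        show "f i x_opt \<le> 0"
          using opt that by (simp add: feasible_set_def)
      qed
      then show ?thesis
        using sum_nonpos[of "{1..m}" "\<lambda>i. lambda_hat idx a N i * f i x_opt"] by simp
    qed
    finally have "?dual \<le> optimal_value Q m f"
      by (simp add: optimal_value_eq[OF assms(8)])
    moreover have "?b - \<epsilon> \<le> ?dual"
      unfolding restricted_dual_def
      by (rule cINF_greatest) (use opt_Q lagr in blast)+
    ultimately show ?thesis
      by linarith
  qed
  show ?thesis
    using part1 part2 sigma_hat_pos by blast
qed

end
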